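(* Let $(M,d)$ be an ultrametric space and let $A,B\subseteq M$ be nonempty spherically complete subsets such that $B$ is bounded and $\delta(B)\le\mathrm{dist}(A,B)$. Let $T:A\cup B\to A\cup B$ be a noncyclic nonexpansive mapping which has the weak-regular property. Then there exist $a\in A$ and $b\in B$ such that $$Ta=a,\qquad Tb=b\qquad\text{and}\qquad d(a,b)=\mathrm{dist}(A,B).$$
   Context: An ultrametric space is a metric space $(M,d)$ with $d(x,y)\le\max\{d(x,z),d(z,y)\}$ for all $x,y,z\in M$. An ultrametric space is spherically complete if each nested sequence of (closed) balls $B_1\supseteq B_2\supseteq\cdots$ has nonempty intersection; a subset of $M$ is spherically complete if it is so as a subspace with the induced metric. For a bounded set $B$, $\delta(B)=\sup\{d(x,y): x,y\in B\}$, and $\mathrm{dist}(A,B)=\inf\{d(a,b): a\in A,\ b\in B\}$. A map $T:A\cup B\to A\cup B$ is noncyclic if $T(A)\subseteq A$ and $T(B)\subseteq B$, and nonexpansive if $d(Tx,Ty)\le d(x,y)$ for all $x,y\in A\cup B$. It has the weak-regular property if $\limsup_{n\to\infty} d(T^nx,T^{n+1}x)<d(x,Tx)$ for each $x\in A\cup B$ with $x\neq Tx$. *)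

theory Defs
  imports "HOL-Analysis.Analysis"
begin

locale Ultrametric_space = Metric_space +
  assumes ultrametric: "\<lbrakk>x \<in> M; y \<in> M; z \<in> M\<rbrakk> \<Longrightarrow> d x y \<le> max (d x z) (d z y)"

text \<open>
  Radii are required to be nonnegative, since \<open>mcball\<close> with a negative radius is empty.
  A subset \<open>A\<close> of \<open>M\<close> is spherically complete as a subspace iff
  \<open>Metric_space.spherically_complete A d\<close>; the balls are then those of \<open>A\<close>, with centres in \<open>A\<close>.
\<close>

definition (in Metric_space) spherically_complete :: bool where
  "spherically_complete \<longleftrightarrow>
     (\<forall>C :: nat \<Rightarrow> 'a set.
        (\<forall>n. \<exists>x\<in>M. \<exists>r\<ge>0. C n = mcball x r) \<and> (\<forall>n. C (Suc n) \<subseteq> C n)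
          \<longrightarrow> (\<Inter>n. C n) \<noteq> {})"

text \<open>
  The library's \<open>diameter\<close> and \<open>setdist\<close> are tied to the type class \<open>metric_space\<close>; these are
  their counterparts for an explicit metric, meaningful for nonempty sets (and, for the diameter,
  bounded ones).
\<close>

definition mdiameter :: "('a \<Rightarrow> 'a \<Rightarrow> real) \<Rightarrow> 'a set \<Rightarrow> real" where
  "mdiameter d S = (SUP (x, y) \<in> S \<times> S. d x y)"

definition msetdist :: "('a \<Rightarrow> 'a \<Rightarrow> real) \<Rightarrow> 'a set \<Rightarrow> 'a set \<Rightarrow> real" where
  "msetdist d A B = (INF (a, b) \<in> A \<times> B. d a b)"

definition noncyclic :: "'a set \<Rightarrow> 'a set \<Rightarrow> ('a \<Rightarrow> 'a) \<Rightarrow> bool" where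
  "noncyclic A B T \<longleftrightarrow> T ` A \<subseteq> A \<and> T ` B \<subseteq> B"

definition nonexpansive_on :: "'a set \<Rightarrow> ('a \<Rightarrow> 'a \<Rightarrow> real) \<Rightarrow> ('a \<Rightarrow> 'a) \<Rightarrow> bool" where
  "nonexpansive_on S d T \<longleftrightarrow> (\<forall>x\<in>S. \<forall>y\<in>S. d (T x) (T y) \<le> d x y)"

definition weak_regular_on :: "'a set \<Rightarrow> ('a \<Rightarrow> 'a \<Rightarrow> real) \<Rightarrow> ('a \<Rightarrow> 'a) \<Rightarrow> bool" where
  "weak_regular_on S d T \<longleftrightarrow>
     (\<forall>x\<in>S. x \<noteq> T x \<longrightarrow>
        limsup (\<lambda>n. ereal (d ((T ^^ n) x) ((T ^^ Suc n) x))) < ereal (d x (T x)))"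

end

theory Submission
  imports Defs
begin

text \<open>
  Call \<open>\<phi> \<ge> 0\<close> a nested radius if \<open>\<phi>\<close> does not increase on passing from a point \<open>x\<close> to a point of
  the ball of radius \<open>\<phi> x\<close> around \<open>x\<close>. In a spherically complete space, choosing nearly minimal
  values of \<open>\<phi>\<close> along such balls produces a nested sequence, and \<open>\<phi>\<close> is constant on the ball of
  radius \<open>\<phi> z\<close> around any point \<open>z\<close> of its intersection.

  For nonexpansive \<open>T\<close> the displacement \<open>d x (T x)\<close> is a nested radius, and the ball around \<open>z\<close> is
  \<open>T\<close>-invariant, so the displacement is constant along the orbit of \<open>z\<close>; weak regularity then
  forces \<open>T z = z\<close>. The distance to a fixed point \<open>b \<in> B\<close> is a nested radius on \<open>A\<close>, so it is
  minimised at some point of \<open>A\<close>; its minimum is \<open>dist(A,B)\<close>, because \<open>\<delta>(B) \<le> dist(A,B)\<close> makes the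
  distance from \<open>a \<in> A\<close> to a point of \<open>B\<close> independent of that point. Hence the ball of radius
  \<open>dist(A,B)\<close> around \<open>b\<close> meets \<open>A\<close> in a nonempty, \<open>T\<close>-invariant, spherically complete set, to which
  the fixed point argument applies again.
\<close>

lemma nonexpansive_on_subset:
  "\<lbrakk>nonexpansive_on S d T; S' \<subseteq> S\<rbrakk> \<Longrightarrow> nonexpansive_on S' d T"
  unfolding nonexpansive_on_def by blast

lemma weak_regular_on_subset:
  "\<lbrakk>weak_regular_on S d T; S' \<subseteq> S\<rbrakk> \<Longrightarrow> weak_regular_on S' d T"
  unfolding weak_regular_on_def by blast

lemma le_msetdistI:
  assumes "A \<noteq> {}" and "B \<noteq> {}" and "\<And>a b. \<lbrakk>a \<in> A; b \<in> B\<rbrakk> \<Longrightarrow> c \<le> d a b"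
  shows "c \<le> msetdist d A B"
  unfolding msetdist_def using assms by (intro cINF_greatest) auto

lemma ex_approx_minimizer:
  fixes f :: "'a \<Rightarrow> real"
  assumes "S \<noteq> {}" and "bdd_below (f ` S)" and "\<epsilon> > 0"
  shows "\<exists>y\<in>S. \<forall>w\<in>S. f y \<le> f w + \<epsilon>"
proof -
  obtain y where y: "y \<in> S" "f y < (INF w\<in>S. f w) + \<epsilon>"
    using cInf_lessD[of "f ` S" "(INF w\<in>S. f w) + \<epsilon>"] assms(1,3) by auto
  have "f y \<le> f w + \<epsilon>" if "w \<in> S" for w
    using cINF_lower[OF assms(2) that] y(2) by linarith
  with y(1) show ?thesis by blast
qed

context Metric_space
begin

lemma msetdist_le_dist:
  assumes "a \<in> A" and "b \<in> B"
  shows "msetdist d A B \<le> d a b"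
  unfolding msetdist_def
  using assms by (intro cINF_lower2[of _ _ "(a, b)"] bdd_belowI2[of _ 0]) auto

lemma dist_le_mdiameter:
  assumes "mbounded S" and "x \<in> S" and "y \<in> S"
  shows "d x y \<le> mdiameter d S"
proof -
  obtain K where "\<And>x y. \<lbrakk>x \<in> S; y \<in> S\<rbrakk> \<Longrightarrow> d x y \<le> K"
    using assms(1) unfolding mbounded_alt by blast
  then show ?thesis
    unfolding mdiameter_def
    using assms(2,3) by (intro cSUP_upper2[of _ _ "(x, y)"] bdd_aboveI2[of _ _ K]) auto
qed

lemma spherically_complete_subspace_iff:
  assumes "S \<subseteq> M"
  shows "Metric_space.spherically_complete S d \<longleftrightarrow>
    (\<forall>C :: nat \<Rightarrow> 'a set.
      (\<forall>n. \<exists>x\<in>S. \<exists>r\<ge>0. C n = S \<inter> mcball x r) \<and> (\<forall>n. C (Suc n) \<subseteq> C n)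
        \<longrightarrow> (\<Inter>n. C n) \<noteq> {})"
proof -
  interpret S: Submetric M d S
    by unfold_locales (fact assms)
  show ?thesis
    unfolding S.sub.spherically_complete_def by (simp add: S.mcball_submetric_eq cong: bex_cong)
qed

definition nested_radius :: "('a \<Rightarrow> real) \<Rightarrow> bool" where
  "nested_radius \<phi> \<longleftrightarrow> (\<forall>x\<in>M. \<phi> x \<ge> 0) \<and> (\<forall>x\<in>M. \<forall>y\<in>mcball x (\<phi> x). \<phi> y \<le> \<phi> x)"

lemma nested_radius_nonneg: "\<lbrakk>nested_radius \<phi>; x \<in> M\<rbrakk> \<Longrightarrow> \<phi> x \<ge> 0"
  by (simp add: nested_radius_def)

lemma nested_radius_le: "\<lbrakk>nested_radius \<phi>; y \<in> mcball x (\<phi> x)\<rbrakk> \<Longrightarrow> \<phi> y \<le> \<phi> x"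
  by (auto simp: nested_radius_def)

lemma nested_radius_minimizing_sequence:
  assumes \<phi>: "nested_radius \<phi>" and "M \<noteq> {}"
  obtains x :: "nat \<Rightarrow> 'a" where "\<And>n. x (Suc n) \<in> mcball (x n) (\<phi> (x n))"
    and "\<And>n w. w \<in> mcball (x n) (\<phi> (x n)) \<Longrightarrow> \<phi> (x (Suc n)) \<le> \<phi> w + inverse (real (Suc n))"
proof -
  define near_min where "near_min n x y \<longleftrightarrow> y \<in> mcball x (\<phi> x) \<and>
      (\<forall>w\<in>mcball x (\<phi> x). \<phi> y \<le> \<phi> w + inverse (real (Suc n)))" for n x y
  have "\<exists>y. y \<in> M \<and> near_min n x y" if "x \<in> M" for x n
  proof -
    have nonempty: "mcball x (\<phi> x) \<noteq> {}"
      using that nested_radius_nonneg[OF \<phi>] by (auto simp: mcball_eq_empty not_less)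
    have bdd: "bdd_below (\<phi> ` mcball x (\<phi> x))"
      by (rule bdd_belowI2[of _ 0]) (use nested_radius_nonneg[OF \<phi>] in auto)
    obtain y where "y \<in> mcball x (\<phi> x)"
      and "\<forall>w\<in>mcball x (\<phi> x). \<phi> y \<le> \<phi> w + inverse (real (Suc n))"
      using ex_approx_minimizer[OF nonempty bdd, of "inverse (real (Suc n))"] by auto
    then show ?thesis
      unfolding near_min_def by auto
  qed
  then obtain x where "\<And>n. near_min n (x n) (x (Suc n))"
    using dependent_nat_choice[of "\<lambda>n y. y \<in> M" near_min] \<open>M \<noteq> {}\<close> by blast
  then show thesis
    by (intro that[of x]) (auto simp: near_min_def)
qed

end

context Ultrametric_space
begin

lemma ultrametric_subspace:
  assumes "S \<subseteq> M"
  shows "Ultrametric_space S d"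
proof -
  interpret S: Metric_space S d using assms by (rule subspace)
  show ?thesis
    by unfold_locales (use assms ultrametric in blast)
qed

lemma mcball_subset_mcball:
  assumes "y \<in> mcball x r" and "s \<le> r"
  shows "mcball y s \<subseteq> mcball x r"
proof
  fix w assume "w \<in> mcball y s"
  then show "w \<in> mcball x r"
    using assms ultrametric[of x w y] by auto
qed

lemma mcball_recentre:
  assumes "y \<in> mcball x r"
  shows "mcball y r = mcball x r"
proof
  have "x \<in> mcball y r"
    using assms by (auto simp: commute)
  then show "mcball x r \<subseteq> mcball y r"
    by (rule mcball_subset_mcball) simp
qed (rule mcball_subset_mcball[OF assms order_refl])

lemma spherically_complete_Int_mcball:
  assumes "A \<subseteq> M" and sc: "Metric_space.spherically_complete A d"
  shows "Metric_space.spherically_complete (A \<inter> mcball x r) d"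
proof -
  let ?S = "A \<inter> mcball x r"
  have ball_Int: "\<exists>s'\<ge>0. ?S \<inter> mcball y s = A \<inter> mcball y s'" if "y \<in> ?S" "s \<ge> 0" for y s
  proof (intro exI conjI)
    have "mcball x r = mcball y r"
      using that mcball_recentre by blast
    moreover have "mcball y r \<inter> mcball y s = mcball y (min r s)"
      by auto
    ultimately show "?S \<inter> mcball y s = A \<inter> mcball y (min r s)"
      by blast
    show "min r s \<ge> 0"
      using that order_trans[OF nonneg, of x y r] by simp
  qed
  have "(\<Inter>n. C n) \<noteq> {}"
    if balls: "\<And>n. \<exists>y\<in>?S. \<exists>s\<ge>0. C n = ?S \<inter> mcball y s" and nested: "\<And>n. C (Suc n) \<subseteq> C n"
    for C :: "nat \<Rightarrow> 'a set"
  proof -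
    have "\<exists>y\<in>A. \<exists>s\<ge>0. C n = A \<inter> mcball y s" for n
    proof -
      obtain y s where "y \<in> ?S" "s \<ge> 0" "C n = ?S \<inter> mcball y s"
        using balls[of n] by blast
      with ball_Int[of y s] show ?thesis by blast
    qed
    then show ?thesis
      using sc nested spherically_complete_subspace_iff[OF \<open>A \<subseteq> M\<close>, THEN iffD1, rule_format, of C]
      by blast
  qed
  moreover have "?S \<subseteq> M"
    by auto
  ultimately show ?thesis
    by (simp add: spherically_complete_subspace_iff)
qed

lemma nested_radius_mcball_subset:
  assumes "nested_radius \<phi>" and "y \<in> mcball x (\<phi> x)"
  shows "mcball y (\<phi> y) \<subseteq> mcball x (\<phi> x)"
  using mcball_subset_mcball nested_radius_le assms by blast

lemma nested_radius_common_point: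
  assumes \<phi>: "nested_radius \<phi>" and sc: spherically_complete
    and x: "\<And>n. x (Suc n) \<in> mcball (x n) (\<phi> (x n))"
  obtains z where "\<And>n. z \<in> mcball (x n) (\<phi> (x n))"
proof -
  let ?C = "\<lambda>n. mcball (x n) (\<phi> (x n))"
  have "\<exists>y\<in>M. \<exists>r\<ge>0. ?C n = mcball y r" for n
    using x[of n] nested_radius_nonneg[OF \<phi>] by auto
  moreover have "?C (Suc n) \<subseteq> ?C n" for n
    using nested_radius_mcball_subset[OF \<phi> x] .
  ultimately have "(\<Inter>n. ?C n) \<noteq> {}"
    using sc[unfolded spherically_complete_def, rule_format, of ?C] by blast
  then show thesis
    using that by blast
qed

lemma nested_radius_constant_on_mcball:
  assumes \<phi>: "nested_radius \<phi>" and "spherically_complete" and "M \<noteq> {}"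
  obtains z where "z \<in> M" and "\<And>y. y \<in> mcball z (\<phi> z) \<Longrightarrow> \<phi> y = \<phi> z"
proof -
  obtain x :: "nat \<Rightarrow> 'a" where x: "\<And>n. x (Suc n) \<in> mcball (x n) (\<phi> (x n))"
    and near_min:
      "\<And>n w. w \<in> mcball (x n) (\<phi> (x n)) \<Longrightarrow> \<phi> (x (Suc n)) \<le> \<phi> w + inverse (real (Suc n))"
    using nested_radius_minimizing_sequence[OF \<phi> \<open>M \<noteq> {}\<close>] by blast
  obtain z where z: "\<And>n. z \<in> mcball (x n) (\<phi> (x n))"
    using nested_radius_common_point[of \<phi> x, OF \<phi> \<open>spherically_complete\<close> x] by blast
  have "\<phi> y = \<phi> z" if y: "y \<in> mcball z (\<phi> z)" for y
  proof (rule antisym)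
    show "\<phi> y \<le> \<phi> z"
      using nested_radius_le[OF \<phi> y] .
    have "\<phi> z - \<phi> y \<le> inverse (real (Suc n))" for n
    proof -
      have "y \<in> mcball (x n) (\<phi> (x n))"
        using nested_radius_mcball_subset[OF \<phi> z] y by blast
      then have "\<phi> (x (Suc n)) \<le> \<phi> y + inverse (real (Suc n))"
        by (rule near_min)
      moreover have "\<phi> z \<le> \<phi> (x (Suc n))"
        using nested_radius_le[OF \<phi> z] .
      ultimately show ?thesis by linarith
    qed
    then have "\<phi> z - \<phi> y \<le> 0"
      by (intro LIMSEQ_le_const[OF LIMSEQ_inverse_real_of_nat]) auto
    then show "\<phi> z \<le> \<phi> y" by simp
  qed
  moreover have "z \<in> M"
    using z[of 0] by simp
  ultimately show thesis
    using that by blast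
qed

lemma image_in_mcball_displacement:
  assumes "T \<in> M \<rightarrow> M" and "nonexpansive_on M d T" and y: "y \<in> mcball x (d x (T x))"
  shows "T y \<in> mcball x (d x (T x))"
proof -
  have "x \<in> M" "y \<in> M" "T x \<in> M" "T y \<in> M" and "d (T x) (T y) \<le> d x y"
    using assms by (auto simp: nonexpansive_on_def)
  then show ?thesis
    using y ultrametric[of x "T y" "T x"] by auto
qed

lemma nested_radius_displacement:
  assumes "T \<in> M \<rightarrow> M" and "nonexpansive_on M d T"
  shows "nested_radius (\<lambda>x. d x (T x))"
  unfolding nested_radius_def
proof (intro conjI ballI)
  fix x y assume y: "y \<in> mcball x (d x (T x))"
  then show "d y (T y) \<le> d x (T x)"
    using image_in_mcball_displacement[OF assms y] ultrametric[of y "T y" x] by (auto simp: commute)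
qed simp

lemma weak_regular_fixpoint:
  assumes "spherically_complete" and "M \<noteq> {}" and T: "T \<in> M \<rightarrow> M"
    and nonexp: "nonexpansive_on M d T" and reg: "weak_regular_on M d T"
  obtains z where "z \<in> M" and "T z = z"
proof -
  obtain z where z: "z \<in> M"
    and const: "\<And>y. y \<in> mcball z (d z (T z)) \<Longrightarrow> d y (T y) = d z (T z)"
    using nested_radius_constant_on_mcball[OF nested_radius_displacement[OF T nonexp]] assms(1,2)
    by blast
  have orbit: "(T ^^ n) z \<in> mcball z (d z (T z))" for n
  proof (induction n)
    case 0
    show ?case using z T by auto
  next
    case (Suc n)
    show ?case
      using image_in_mcball_displacement[OF T nonexp Suc.IH] by simp
  qed
  have "T z = z"
  proof (rule ccontr)
    assume "T z \<noteq> z"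
    then have "limsup (\<lambda>n. ereal (d ((T ^^ n) z) ((T ^^ Suc n) z))) < ereal (d z (T z))"
      using reg z unfolding weak_regular_on_def by metis
    then show False
      using const[OF orbit] by (simp add: Limsup_const)
  qed
  with z show thesis by (rule that)
qed

lemma weak_regular_fixpoint_in_subset:
  assumes "S \<subseteq> M" and "S \<noteq> {}" and "Metric_space.spherically_complete S d"
    and "T \<in> S \<rightarrow> S" and "S \<subseteq> S'" and "nonexpansive_on S' d T" and "weak_regular_on S' d T"
  obtains z where "z \<in> S" and "T z = z"
proof -
  interpret S: Ultrametric_space S d
    using \<open>S \<subseteq> M\<close> by (rule ultrametric_subspace)
  have "nonexpansive_on S d T" and "weak_regular_on S d T"
    using assms(5-7) nonexpansive_on_subset weak_regular_on_subset by blast+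
  with assms(2-4) show thesis
    using S.weak_regular_fixpoint that by blast
qed

lemma spherically_complete_nearest_point:
  assumes "A \<subseteq> M" and "A \<noteq> {}" and "Metric_space.spherically_complete A d" and "p \<in> M"
  obtains z where "z \<in> A" and "\<And>a. a \<in> A \<Longrightarrow> d z p \<le> d a p"
proof -
  interpret A: Ultrametric_space A d
    using \<open>A \<subseteq> M\<close> by (rule ultrametric_subspace)
  have in_M: "a \<in> M" if "a \<in> A" for a
    using that \<open>A \<subseteq> M\<close> by blast
  have "d y p \<le> d x p" if "y \<in> A.mcball x (d x p)" for x y
    using that ultrametric[of y p x] in_M \<open>p \<in> M\<close> by (auto simp: commute)
  then have "A.nested_radius (\<lambda>a. d a p)"
    by (simp add: A.nested_radius_def)
  then obtain z where z: "z \<in> A"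
    and const: "\<And>y. y \<in> A.mcball z (d z p) \<Longrightarrow> d y p = d z p"
    using A.nested_radius_constant_on_mcball assms(2,3) by blast
  have "d z p \<le> d a p" if "a \<in> A" for a
  proof (rule ccontr)
    assume closer: "\<not> d z p \<le> d a p"
    then have "a \<in> A.mcball z (d z p)"
      using ultrametric[of z a p] z that in_M \<open>p \<in> M\<close> by (auto simp: commute)
    then show False
      using const[of a] closer by simp
  qed
  with z show thesis by (rule that)
qed

lemma msetdist_attained:
  assumes "A \<subseteq> M" and "B \<subseteq> M" and "A \<noteq> {}" and "Metric_space.spherically_complete A d"
    and "mbounded B" and diam: "mdiameter d B \<le> msetdist d A B" and "b \<in> B"
  obtains z where "z \<in> A" and "d z b = msetdist d A B"
proof -
  have equidistant: "d a b \<le> d a b'" if "a \<in> A" "b' \<in> B" for a b'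
  proof -
    have "d b' b \<le> d a b'"
      using dist_le_mdiameter[OF \<open>mbounded B\<close> \<open>b' \<in> B\<close> \<open>b \<in> B\<close>] diam
        msetdist_le_dist[OF that] by linarith
    then show ?thesis
      using ultrametric[of a b b'] that assms(1,2) \<open>b \<in> B\<close> by fastforce
  qed
  obtain z where z: "z \<in> A" "\<And>a. a \<in> A \<Longrightarrow> d z b \<le> d a b"
    using spherically_complete_nearest_point[of A b] assms by blast
  have "d z b \<le> msetdist d A B"
    using z(2) equidistant \<open>A \<noteq> {}\<close> \<open>b \<in> B\<close> by (intro le_msetdistI) (auto intro: order_trans)
  then have "d z b = msetdist d A B"
    using msetdist_le_dist[OF z(1) \<open>b \<in> B\<close>] by (rule antisym)
  with z(1) show thesis by (rule that)
qed

lemma nonexpansive_on_Int_mcball_invariant: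
  assumes "nonexpansive_on S d T" and "A \<subseteq> S" and "A \<subseteq> M" and "T \<in> A \<rightarrow> A"
    and "p \<in> S" and "T p = p"
  shows "T \<in> A \<inter> mcball p r \<rightarrow> A \<inter> mcball p r"
proof
  fix x assume x: "x \<in> A \<inter> mcball p r"
  then have "d (T p) (T x) \<le> d p x"
    using assms(1,2,5) unfolding nonexpansive_on_def by blast
  then show "T x \<in> A \<inter> mcball p r"
    using x assms(3,4,6) by auto
qed

end

theorem theorem2p9:
  fixes M :: "'a set" and d :: "'a \<Rightarrow> 'a \<Rightarrow> real" and A B :: "'a set" and T :: "'a \<Rightarrow> 'a"
  assumes "Ultrametric_space M d"
    and "A \<subseteq> M" and "B \<subseteq> M" and "A \<noteq> {}" and "B \<noteq> {}"
    and "Metric_space.spherically_complete A d"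
    and "Metric_space.spherically_complete B d"
    and "Metric_space.mbounded M d B"
    and "mdiameter d B \<le> msetdist d A B"
    and "T \<in> A \<union> B \<rightarrow> A \<union> B"
    and "noncyclic A B T"
    and "nonexpansive_on (A \<union> B) d T"
    and "weak_regular_on (A \<union> B) d T"
  shows "\<exists>a\<in>A. \<exists>b\<in>B. T a = a \<and> T b = b \<and> d a b = msetdist d A B"
proof -
  interpret Ultrametric_space M d by fact
  have TA: "T \<in> A \<rightarrow> A" and TB: "T \<in> B \<rightarrow> B"
    using \<open>noncyclic A B T\<close> by (auto simp: noncyclic_def)
  obtain b where b: "b \<in> B" "T b = b"
    using weak_regular_fixpoint_in_subset[OF assms(3,5,7) TB Un_upper2 assms(12,13)] .
  let ?S = "A \<inter> mcball b (msetdist d A B)"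
  obtain z where "z \<in> A" "d z b = msetdist d A B"
    using msetdist_attained[OF assms(2,3,4,6,8,9) b(1)] .
  then have "z \<in> ?S"
    using b assms(2,3) by (auto simp: commute)
  moreover have "T \<in> ?S \<rightarrow> ?S"
    using nonexpansive_on_Int_mcball_invariant[OF assms(12) Un_upper1 assms(2) TA] b by blast
  moreover have "Metric_space.spherically_complete (?S) d"
    using assms(2,6) by (rule spherically_complete_Int_mcball)
  moreover have "?S \<subseteq> M" and "?S \<subseteq> A \<union> B"
    by auto
  ultimately obtain a where a: "a \<in> ?S" "T a = a"
    using weak_regular_fixpoint_in_subset assms(12,13) by (metis empty_iff)
  then have "d a b = msetdist d A B"
    using msetdist_le_dist[of a A b B] b by (auto simp: commute)
  with a b show ?thesis by blast
qed

end
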